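(* Let $K$ be the Kronecker quiver, i.e. the quiver with vertices $1,2$ and two arrows $\alpha,\beta:1\to2$, and let $\mathcal{H}=\ell^2(\mathbb{Z})$. Fix a constant $\lambda>1$. Define sequences $a=(a(n))_{n\in\mathbb{Z}}$ and $b=(b(n))_{n\in\mathbb{Z}}$ by $$a(n)=\begin{cases}e^{-\lambda^n}& (n\ge1,\ n\text{ even})\\ 1&(\text{otherwise})\end{cases},\qquad b(n)=\begin{cases}e^{-\lambda^n}& (n\ge1,\ n\text{ odd})\\ 1&(\text{otherwise}).\end{cases}$$ Let $D_a$ and $D_b$ be the diagonal operators on $\mathcal{H}$ with diagonal coefficients $a$ and $b$ respectively, let $U$ be the bilateral forward shift on $\mathcal{H}$ ($Ue_n=e_{n+1}$), and put $A=D_a$, $B=UD_b$. Let $(H^\lambda,f^\lambda)$ be the Hilbert representation of $K$ with $H^\lambda_1=H^\lambda_2=\mathcal{H}$, $f^\lambda_\alpha=A$ and $f^\lambda_\beta=B$. Then $(H^\lambda,f^\lambda)$ is transitive, and it is not isomorphic to any Hilbert representation of rank-one perturbation type (as defined in the context).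
   Context: All Hilbert spaces are complex. A Hilbert representation $(H,f)$ of the Kronecker quiver consists of two Hilbert spaces $H_1,H_2$ and two bounded linear operators $f_\alpha,f_\beta:H_1\to H_2$. A homomorphism $(H,f)\to(L,g)$ is a pair $(T_1,T_2)$ of bounded operators $T_i:H_i\to L_i$ with $T_2f_\alpha=g_\alpha T_1$ and $T_2f_\beta=g_\beta T_1$; it is an isomorphism if $T_1,T_2$ are both (boundedly) invertible. $End(H,f)$ is the algebra of homomorphisms from $(H,f)$ to itself, and $(H,f)$ is transitive if $End(H,f)=\mathbb{C}I$, where $I=(I_{H_1},I_{H_2})$. A Hilbert representation $(H,f)$ of $K$ is here said to be of rank-one perturbation type if it is of the following form: $H_1=H_2=\ell^2(\mathbb{N})$ with canonical basis $\{e_1,e_2,\dots\}$, $f_\alpha=S$ is the unilateral shift ($Se_n=e_{n+1}$), and $f_\beta=SD_\nu+\theta_{e_1,\overline{w}}$, where $D_\nu=\mathrm{diag}(\nu_1,\nu_2,\dots)$ for a bounded complex sequence $\nu=(\nu_i)$ with $\nu_i\ne\nu_j$ for $i\neq j$, $\overline{w}=(\overline{w_n})_n\in\ell^2(\mathbb{N})$ satisfies $w_n\ne0$ for all $n$, and $\theta_{e_1,\overline{w}}(x)=(x\mid\overline{w})e_1$ (inner product linear in the first variable). *)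

theory Defs
  imports "HOL-Analysis.Analysis"
begin

section \<open>Complex Hilbert spaces and bounded operators\<close>

text \<open>The inner product is linear in the first variable. Real scalar multiplication, norm and
  completeness are inherited from class \<^class>\<open>banach\<close> and tied to the complex structure.\<close>

class complex_hilbert_space = banach +
  fixes scaleC :: "complex \<Rightarrow> 'a \<Rightarrow> 'a"  (infixr "*\<^sub>C" 75)
    and cinner :: "'a \<Rightarrow> 'a \<Rightarrow> complex"
  assumes scaleC_add_right: "c *\<^sub>C (x + y) = c *\<^sub>C x + c *\<^sub>C y"
    and scaleC_add_left: "(c + d) *\<^sub>C x = c *\<^sub>C x + d *\<^sub>C x"
    and scaleC_scaleC: "c *\<^sub>C d *\<^sub>C x = (c * d) *\<^sub>C x"
    and scaleC_one: "1 *\<^sub>C x = x"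
    and scaleR_scaleC: "r *\<^sub>R x = complex_of_real r *\<^sub>C x"
    and cinner_commute: "cinner x y = cnj (cinner y x)"
    and cinner_add_left: "cinner (x + y) z = cinner x z + cinner y z"
    and cinner_scaleC_left: "cinner (c *\<^sub>C x) y = c * cinner x y"
    and cinner_norm: "cinner x x = complex_of_real ((norm x)\<^sup>2)"

definition bounded_clinear :: "('a::complex_hilbert_space \<Rightarrow> 'b::complex_hilbert_space) \<Rightarrow> bool"
  where "bounded_clinear f \<longleftrightarrow> bounded_linear f \<and> (\<forall>c x. f (c *\<^sub>C x) = c *\<^sub>C f x)"

definition boundedly_invertible :: "('a::complex_hilbert_space \<Rightarrow> 'b::complex_hilbert_space) \<Rightarrow> bool"
  where "boundedly_invertible T \<longleftrightarrow>
    bounded_clinear T \<and> (\<exists>R. bounded_clinear R \<and> R \<circ> T = id \<and> T \<circ> R = id)"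

text \<open>\<open>rank_one u v\<close> is the operator \<open>\<theta>\<^bsub>u,v\<^esub>\<close>, sending \<open>x\<close> to \<open>(x | v) u\<close>.\<close>

definition rank_one :: "'b::complex_hilbert_space \<Rightarrow> 'a::complex_hilbert_space \<Rightarrow> 'a \<Rightarrow> 'b"
  where "rank_one u v x = cinner x v *\<^sub>C u"


section \<open>Hilbert representations of the Kronecker quiver\<close>

text \<open>The Hilbert spaces at the vertices 1 and 2 are the types \<open>'a\<close> and \<open>'b\<close>.\<close>

record ('a, 'b) kronecker =
  op_alpha :: "'a \<Rightarrow> 'b"
  op_beta :: "'a \<Rightarrow> 'b"

definition hilbert_rep ::
    "('a::complex_hilbert_space, 'b::complex_hilbert_space) kronecker \<Rightarrow> bool"
  where "hilbert_rep F \<longleftrightarrow> bounded_clinear (op_alpha F) \<and> bounded_clinear (op_beta F)"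

definition rep_hom ::
    "('a::complex_hilbert_space, 'b::complex_hilbert_space) kronecker \<Rightarrow>
     ('c::complex_hilbert_space, 'd::complex_hilbert_space) kronecker \<Rightarrow>
     (('a \<Rightarrow> 'c) \<times> ('b \<Rightarrow> 'd)) set"
  where "rep_hom F G = {(T1, T2). bounded_clinear T1 \<and> bounded_clinear T2 \<and>
    T2 \<circ> op_alpha F = op_alpha G \<circ> T1 \<and> T2 \<circ> op_beta F = op_beta G \<circ> T1}"

definition rep_isomorphic ::
    "('a::complex_hilbert_space, 'b::complex_hilbert_space) kronecker \<Rightarrow>
     ('c::complex_hilbert_space, 'd::complex_hilbert_space) kronecker \<Rightarrow> bool"
  where "rep_isomorphic F G \<longleftrightarrow>
    (\<exists>(T1, T2) \<in> rep_hom F G. boundedly_invertible T1 \<and> boundedly_invertible T2)"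

definition transitive_rep ::
    "('a::complex_hilbert_space, 'b::complex_hilbert_space) kronecker \<Rightarrow> bool"
  where "transitive_rep F \<longleftrightarrow>
    rep_hom F F = range (\<lambda>c. (\<lambda>x. c *\<^sub>C x, \<lambda>y. c *\<^sub>C y))"


section \<open>The Hilbert space of square-summable families\<close>

definition square_summable :: "('i \<Rightarrow> complex) \<Rightarrow> bool"
  where "square_summable x \<longleftrightarrow> (\<lambda>i. (cmod (x i))\<^sup>2) summable_on UNIV"

lemma square_summable_bound:
  assumes "\<And>F. finite F \<Longrightarrow> (\<Sum>i\<in>F. (cmod (x i))\<^sup>2) \<le> C"
  shows "square_summable x"
  unfolding square_summable_def
  by (rule nonneg_bdd_above_summable_on) (auto intro!: bdd_aboveI2 assms)

lemma square_summable_sum_le: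
  assumes "square_summable x" "finite F"
  shows "(\<Sum>i\<in>F. (cmod (x i))\<^sup>2) \<le> (\<Sum>\<^sub>\<infinity>i. (cmod (x i))\<^sup>2)"
  using assms unfolding square_summable_def by (intro finite_sum_le_infsum) auto

lemma L2_set_add_cmod_le:
  "L2_set (\<lambda>i. cmod (x i + y i)) F \<le> L2_set (\<lambda>i. cmod (x i)) F + L2_set (\<lambda>i. cmod (y i)) F"
proof -
  have "L2_set (\<lambda>i. cmod (x i + y i)) F \<le> L2_set (\<lambda>i. cmod (x i) + cmod (y i)) F"
    by (rule L2_set_mono) (auto intro: norm_triangle_ineq)
  also have "\<dots> \<le> L2_set (\<lambda>i. cmod (x i)) F + L2_set (\<lambda>i. cmod (y i)) F"
    by (rule L2_set_triangle_ineq)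
  finally show ?thesis .
qed

lemma L2_set_le_square_summable:
  assumes "square_summable x" "finite F"
  shows "L2_set (\<lambda>i. cmod (x i)) F \<le> sqrt (\<Sum>\<^sub>\<infinity>i. (cmod (x i))\<^sup>2)"
  unfolding L2_set_def using square_summable_sum_le[OF assms] by simp

lemma sum_le_square_of_L2_set:
  assumes "L2_set (\<lambda>i. cmod (x i)) F \<le> C"
  shows "(\<Sum>i\<in>F. (cmod (x i))\<^sup>2) \<le> C\<^sup>2"
  using assms unfolding L2_set_def by (rule sqrt_le_D)

lemma square_summable_add:
  assumes "square_summable x" "square_summable y"
  shows "square_summable (\<lambda>i. x i + y i)"
proof (rule square_summable_bound, rule sum_le_square_of_L2_set)
  fix F :: "'a set" assume F: "finite F"
  show "L2_set (\<lambda>i. cmod (x i + y i)) F \<le>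
      sqrt (\<Sum>\<^sub>\<infinity>i. (cmod (x i))\<^sup>2) + sqrt (\<Sum>\<^sub>\<infinity>i. (cmod (y i))\<^sup>2)"
    using L2_set_add_cmod_le[of x y F] L2_set_le_square_summable[OF assms(1) F]
      L2_set_le_square_summable[OF assms(2) F] by linarith
qed

lemma square_summable_mult:
  assumes "square_summable x" "\<And>i. cmod (a i) \<le> C"
  shows "square_summable (\<lambda>i. a i * x i)"
  unfolding square_summable_def
proof (rule summable_on_comparison_test)
  show "(\<lambda>i. C\<^sup>2 * (cmod (x i))\<^sup>2) summable_on UNIV"
    using assms(1) unfolding square_summable_def by (rule summable_on_cmult_right)
  show "(cmod (a i * x i))\<^sup>2 \<le> C\<^sup>2 * (cmod (x i))\<^sup>2" for i
    using power_mono[OF assms(2)[of i], of 2]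
    by (simp add: norm_mult power_mult_distrib mult_right_mono)
qed auto

lemma square_summable_cmult: "square_summable x \<Longrightarrow> square_summable (\<lambda>i. c * x i)"
  by (rule square_summable_mult[where C = "cmod c"]) auto

lemma square_summable_zero: "square_summable (\<lambda>_. 0)"
  by (simp add: square_summable_def)

lemma square_summable_cinner:
  assumes "square_summable x" "square_summable y"
  shows "(\<lambda>i. x i * cnj (y i)) summable_on UNIV"
proof (rule abs_summable_summable, rule Infinite_Sum.abs_summable_on_comparison_test')
  show "(\<lambda>i. (cmod (x i))\<^sup>2 + (cmod (y i))\<^sup>2) summable_on UNIV"
    using assms unfolding square_summable_def by (rule summable_on_add)
  show "norm (x i * cnj (y i)) \<le> (cmod (x i))\<^sup>2 + (cmod (y i))\<^sup>2" for i
  proof -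
    have "2 * cmod (x i) * cmod (y i) \<le> (cmod (x i))\<^sup>2 + (cmod (y i))\<^sup>2"
      by (rule sum_squares_bound)
    moreover have "0 \<le> cmod (x i) * cmod (y i)" by simp
    ultimately show ?thesis unfolding norm_mult complex_mod_cnj by linarith
  qed
qed

typedef 'i ell2 = "{x :: 'i \<Rightarrow> complex. square_summable x}"
  morphisms coeff ell2
  using square_summable_zero by blast

lemma square_summable_coeff: "square_summable (coeff x)"
  using coeff by blast

lemma coeff_ell2: "square_summable x \<Longrightarrow> coeff (ell2 x) = x"
  by (simp add: ell2_inverse)

lemma ell2_eqI: "(\<And>i. coeff x i = coeff y i) \<Longrightarrow> x = y"
  by (metis coeff_inject ext)

instantiation ell2 :: (type) real_vector
begin

definition zero_ell2 :: "'a ell2" where "0 = ell2 (\<lambda>_. 0)"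
definition plus_ell2 :: "'a ell2 \<Rightarrow> 'a ell2 \<Rightarrow> 'a ell2"
  where "x + y = ell2 (\<lambda>i. coeff x i + coeff y i)"
definition uminus_ell2 :: "'a ell2 \<Rightarrow> 'a ell2"
  where "- x = ell2 (\<lambda>i. - coeff x i)"
definition minus_ell2 :: "'a ell2 \<Rightarrow> 'a ell2 \<Rightarrow> 'a ell2"
  where "x - y = ell2 (\<lambda>i. coeff x i - coeff y i)"
definition scaleR_ell2 :: "real \<Rightarrow> 'a ell2 \<Rightarrow> 'a ell2"
  where "r *\<^sub>R x = ell2 (\<lambda>i. complex_of_real r * coeff x i)"

lemma coeff_zero: "coeff 0 i = 0"
  by (simp add: zero_ell2_def coeff_ell2 square_summable_zero)

lemma coeff_add: "coeff (x + y) i = coeff x i + coeff y i"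
  by (simp add: plus_ell2_def coeff_ell2 square_summable_add square_summable_coeff)

lemma coeff_uminus: "coeff (- x) i = - coeff x i"
  using square_summable_cmult[OF square_summable_coeff, of "-1" x]
  by (simp add: uminus_ell2_def coeff_ell2)

lemma coeff_diff: "coeff (x - y) i = coeff x i - coeff y i"
  using square_summable_add[OF square_summable_coeff[of x]
      square_summable_cmult[OF square_summable_coeff[of y], of "-1"]]
  by (simp add: minus_ell2_def coeff_ell2)

lemma coeff_scaleR: "coeff (r *\<^sub>R x) i = complex_of_real r * coeff x i"
  by (simp add: scaleR_ell2_def coeff_ell2 square_summable_cmult square_summable_coeff)

instance
proof
  fix x y z :: "'a ell2" and r s :: real
  show "x + y + z = x + (y + z)" by (rule ell2_eqI) (simp add: coeff_add)
  show "x + y = y + x" by (rule ell2_eqI) (simp add: coeff_add)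
  show "0 + x = x" by (rule ell2_eqI) (simp add: coeff_add coeff_zero)
  show "- x + x = 0" by (rule ell2_eqI) (simp add: coeff_add coeff_uminus coeff_zero)
  show "x - y = x + - y" by (rule ell2_eqI) (simp add: coeff_add coeff_uminus coeff_diff)
  show "r *\<^sub>R (x + y) = r *\<^sub>R x + r *\<^sub>R y"
    by (rule ell2_eqI) (simp add: coeff_add coeff_scaleR algebra_simps)
  show "(r + s) *\<^sub>R x = r *\<^sub>R x + s *\<^sub>R x"
    by (rule ell2_eqI) (simp add: coeff_add coeff_scaleR algebra_simps)
  show "r *\<^sub>R s *\<^sub>R x = (r * s) *\<^sub>R x" by (rule ell2_eqI) (simp add: coeff_scaleR)
  show "1 *\<^sub>R x = x" by (rule ell2_eqI) (simp add: coeff_scaleR)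
qed

end

instantiation ell2 :: (type) real_normed_vector
begin

definition norm_ell2 :: "'a ell2 \<Rightarrow> real"
  where "norm x = sqrt (\<Sum>\<^sub>\<infinity>i. (cmod (coeff x i))\<^sup>2)"
definition sgn_ell2 :: "'a ell2 \<Rightarrow> 'a ell2"
  where "sgn_ell2 x = x /\<^sub>R norm x"
definition dist_ell2 :: "'a ell2 \<Rightarrow> 'a ell2 \<Rightarrow> real"
  where "dist_ell2 x y = norm (x - y)"
definition uniformity_ell2 :: "('a ell2 \<times> 'a ell2) filter"
  where "uniformity = (INF e\<in>{0<..}. principal {(x, y). dist (x :: 'a ell2) y < e})"
definition open_ell2 :: "'a ell2 set \<Rightarrow> bool"
  where "open_ell2 U \<longleftrightarrow> (\<forall>x\<in>U. eventually (\<lambda>(x', y). x' = x \<longrightarrow> y \<in> U) uniformity)"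

lemma L2_set_coeff_le_norm:
  "finite F \<Longrightarrow> L2_set (\<lambda>i. cmod (coeff x i)) F \<le> norm x"
  unfolding norm_ell2_def by (rule L2_set_le_square_summable[OF square_summable_coeff])

lemma norm_ell2_le:
  assumes "\<And>F. finite F \<Longrightarrow> L2_set (\<lambda>i. cmod (coeff x i)) F \<le> C"
  shows "norm x \<le> C"
proof -
  have "0 \<le> C" using assms[of "{}"] by simp
  moreover have "(\<Sum>\<^sub>\<infinity>i. (cmod (coeff x i))\<^sup>2) \<le> C\<^sup>2"
    using square_summable_coeff[of x] unfolding square_summable_def
    by (rule infsum_le_finite_sums) (auto intro: sum_le_square_of_L2_set assms)
  ultimately show ?thesis
    unfolding norm_ell2_def by (simp add: real_le_lsqrt infsum_nonneg)
qed

lemma cmod_coeff_le_norm: "cmod (coeff x i) \<le> norm x"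
  using L2_set_coeff_le_norm[of "{i}" x] by simp

instance
proof
  fix x y :: "'a ell2" and r :: real
  show "norm x = 0 \<longleftrightarrow> x = 0"
  proof
    assume "norm x = 0"
    then show "x = 0" using cmod_coeff_le_norm[of x] by (intro ell2_eqI) (simp add: coeff_zero)
  qed (simp add: norm_ell2_def coeff_zero)
  show "norm (x + y) \<le> norm x + norm y"
  proof (rule norm_ell2_le)
    fix F :: "'a set" assume "finite F"
    then show "L2_set (\<lambda>i. cmod (coeff (x + y) i)) F \<le> norm x + norm y"
      using L2_set_add_cmod_le[of "coeff x" "coeff y" F]
        L2_set_coeff_le_norm[of F x] L2_set_coeff_le_norm[of F y]
      by (simp add: coeff_add)
  qed
  show "norm (r *\<^sub>R x) = \<bar>r\<bar> * norm x"
    by (simp add: norm_ell2_def coeff_scaleR norm_mult power_mult_distrib infsum_cmult_right'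
        real_sqrt_mult)
qed (simp_all add: sgn_ell2_def dist_ell2_def uniformity_ell2_def open_ell2_def)

end

instance ell2 :: (type) banach
proof
  fix X :: "nat \<Rightarrow> 'a ell2"
  assume "Cauchy X"
  have "Cauchy (\<lambda>n. coeff (X n) i)" for i
  proof (rule metric_CauchyI)
    fix e :: real assume "0 < e"
    then obtain N where "\<And>m n. m \<ge> N \<Longrightarrow> n \<ge> N \<Longrightarrow> dist (X m) (X n) < e"
      using \<open>Cauchy X\<close> by (meson metric_CauchyD)
    then show "\<exists>M. \<forall>m\<ge>M. \<forall>n\<ge>M. dist (coeff (X m) i) (coeff (X n) i) < e"
      unfolding dist_norm coeff_diff[symmetric] by (meson cmod_coeff_le_norm le_less_trans)
  qed
  then have "\<exists>l. (\<lambda>n. coeff (X n) i) \<longlonglongrightarrow> l" for i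
    using Cauchy_convergent convergent_def by blast
  then obtain l where l: "\<And>i. (\<lambda>n. coeff (X n) i) \<longlonglongrightarrow> l i"
    by metis
  have close: "\<exists>N. \<forall>n\<ge>N. \<forall>F. finite F \<longrightarrow> L2_set (\<lambda>i. cmod (coeff (X n) i - l i)) F \<le> e"
    if "0 < e" for e
  proof -
    obtain N where N: "\<And>m n. m \<ge> N \<Longrightarrow> n \<ge> N \<Longrightarrow> dist (X m) (X n) < e"
      using \<open>Cauchy X\<close> \<open>0 < e\<close> by (meson metric_CauchyD)
    have "L2_set (\<lambda>i. cmod (coeff (X n) i - l i)) F \<le> e" if "n \<ge> N" "finite F" for n F
    proof (rule tendsto_upperbound)
      show "(\<lambda>m. L2_set (\<lambda>i. cmod (coeff (X n) i - coeff (X m) i)) F)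
          \<longlonglongrightarrow> L2_set (\<lambda>i. cmod (coeff (X n) i - l i)) F"
        unfolding L2_set_def by (intro tendsto_intros l)
      show "\<forall>\<^sub>F m in sequentially. L2_set (\<lambda>i. cmod (coeff (X n) i - coeff (X m) i)) F \<le> e"
        unfolding eventually_sequentially
      proof (intro exI allI impI)
        fix m assume "N \<le> m"
        then show "L2_set (\<lambda>i. cmod (coeff (X n) i - coeff (X m) i)) F \<le> e"
          using N[OF \<open>n \<ge> N\<close>, of m] L2_set_coeff_le_norm[OF \<open>finite F\<close>, of "X n - X m"]
          by (simp add: dist_norm coeff_diff)
      qed
    qed simp
    then show ?thesis by blast
  qed
  have "square_summable l"
  proof -
    obtain N where N: "\<And>F. finite F \<Longrightarrow> L2_set (\<lambda>i. cmod (coeff (X N) i - l i)) F \<le> 1"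
      using close[of 1] by auto
    have "square_summable (\<lambda>i. coeff (X N) i - l i)"
      by (rule square_summable_bound, rule sum_le_square_of_L2_set, rule N)
    from square_summable_add[OF square_summable_coeff[of "X N"] square_summable_cmult[OF this, of "-1"]]
    show ?thesis by simp
  qed
  have "X \<longlonglongrightarrow> ell2 l"
  proof (rule metric_LIMSEQ_I)
    fix e :: real assume "0 < e"
    then obtain N where
      N: "\<And>n F. n \<ge> N \<Longrightarrow> finite F \<Longrightarrow> L2_set (\<lambda>i. cmod (coeff (X n) i - l i)) F \<le> e / 2"
      using close[of "e / 2"] by auto
    have "norm (X n - ell2 l) \<le> e / 2" if "n \<ge> N" for n
      by (rule norm_ell2_le)
         (unfold coeff_diff coeff_ell2[OF \<open>square_summable l\<close>], rule N[OF that])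
    then show "\<exists>N. \<forall>n\<ge>N. dist (X n) (ell2 l) < e"
      unfolding dist_norm using \<open>0 < e\<close> by (intro exI[of _ N]) fastforce
  qed
  then show "convergent X" by (rule convergentI)
qed

instantiation ell2 :: (type) complex_hilbert_space
begin

definition scaleC_ell2 :: "complex \<Rightarrow> 'a ell2 \<Rightarrow> 'a ell2"
  where "c *\<^sub>C x = ell2 (\<lambda>i. c * coeff x i)"
definition cinner_ell2 :: "'a ell2 \<Rightarrow> 'a ell2 \<Rightarrow> complex"
  where "cinner x y = (\<Sum>\<^sub>\<infinity>i. coeff x i * cnj (coeff y i))"

lemma coeff_scaleC: "coeff (c *\<^sub>C x) i = c * coeff x i"
  by (simp add: scaleC_ell2_def coeff_ell2 square_summable_cmult square_summable_coeff)

instance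
proof
  fix x y z :: "'a ell2" and c d :: complex and r :: real
  show "c *\<^sub>C (x + y) = c *\<^sub>C x + c *\<^sub>C y"
    by (rule ell2_eqI) (simp add: coeff_add coeff_scaleC algebra_simps)
  show "(c + d) *\<^sub>C x = c *\<^sub>C x + d *\<^sub>C x"
    by (rule ell2_eqI) (simp add: coeff_add coeff_scaleC algebra_simps)
  show "c *\<^sub>C d *\<^sub>C x = (c * d) *\<^sub>C x" by (rule ell2_eqI) (simp add: coeff_scaleC)
  show "1 *\<^sub>C x = x" by (rule ell2_eqI) (simp add: coeff_scaleC)
  show "r *\<^sub>R x = complex_of_real r *\<^sub>C x"
    by (rule ell2_eqI) (simp add: coeff_scaleC coeff_scaleR)
  show "cinner x y = cnj (cinner y x)"
    unfolding cinner_ell2_def infsum_cnj[symmetric] by (simp add: mult.commute)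
  show "cinner (x + y) z = cinner x z + cinner y z"
    by (simp add: cinner_ell2_def coeff_add distrib_right infsum_add square_summable_cinner
        square_summable_coeff)
  show "cinner (c *\<^sub>C x) y = c * cinner x y"
    by (simp add: cinner_ell2_def coeff_scaleC mult.assoc infsum_cmult_right')
  have "cinner x x = (\<Sum>\<^sub>\<infinity>i. complex_of_real ((cmod (coeff x i))\<^sup>2))"
    unfolding cinner_ell2_def by (simp only: complex_norm_square)
  also have "\<dots> = complex_of_real (\<Sum>\<^sub>\<infinity>i. (cmod (coeff x i))\<^sup>2)"
    using square_summable_coeff[of x] unfolding square_summable_def
    by (intro infsumI has_sum_of_real has_sum_infsum)
  also have "\<dots> = complex_of_real ((norm x)\<^sup>2)"
    by (simp add: norm_ell2_def infsum_nonneg)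
  finally show "cinner x x = complex_of_real ((norm x)\<^sup>2)" .
qed

end

lemma bounded_clinear_ell2I:
  fixes T :: "'i ell2 \<Rightarrow> 'j ell2"
  assumes "\<And>x y. T (x + y) = T x + T y" "\<And>c x. T (c *\<^sub>C x) = c *\<^sub>C T x"
    and "\<And>x. norm (T x) \<le> norm x * K"
  shows "bounded_clinear T"
  unfolding bounded_clinear_def
  by (intro conjI allI bounded_linear_intro[of _ K]) (simp_all add: assms scaleR_scaleC)


section \<open>Operators on square-summable families\<close>

definition basis_vec :: "'i \<Rightarrow> 'i ell2"
  where "basis_vec i = ell2 (\<lambda>j. if j = i then 1 else 0)"

text \<open>Since \<^const>\<open>ell2\<close> is unspecified outside the square-summable families, \<open>diag_op a\<close> is
  meaningful for bounded \<open>a\<close> only.\<close>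

definition diag_op :: "('i \<Rightarrow> complex) \<Rightarrow> 'i ell2 \<Rightarrow> 'i ell2"
  where "diag_op a x = ell2 (\<lambda>i. a i * coeff x i)"

definition bilateral_shift :: "int ell2 \<Rightarrow> int ell2"
  where "bilateral_shift x = ell2 (\<lambda>n. coeff x (n - 1))"

definition unilateral_shift :: "nat ell2 \<Rightarrow> nat ell2"
  where "unilateral_shift x = ell2 (\<lambda>n. case n of 0 \<Rightarrow> 0 | Suc m \<Rightarrow> coeff x m)"

lemma square_summable_shift:
  assumes "square_summable (x :: nat \<Rightarrow> complex)"
  shows "square_summable (\<lambda>n. case n of 0 \<Rightarrow> 0 | Suc m \<Rightarrow> x m)"
    and "(\<Sum>\<^sub>\<infinity>n. (cmod (case n of 0 \<Rightarrow> 0 | Suc m \<Rightarrow> x m))\<^sup>2) = (\<Sum>\<^sub>\<infinity>n. (cmod (x n))\<^sup>2)"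
proof -
  let ?g = "\<lambda>n. (cmod (case n of 0 \<Rightarrow> 0 | Suc m \<Rightarrow> x m))\<^sup>2"
  have eq: "?g \<circ> Suc = (\<lambda>n. (cmod (x n))\<^sup>2)" by auto
  have out: "?g n = 0" if "n \<notin> range Suc" for n
    using that by (cases n) auto
  have "?g summable_on range Suc"
    using assms by (simp add: summable_on_reindex eq square_summable_def)
  moreover have "?g summable_on range Suc \<longleftrightarrow> ?g summable_on UNIV"
    by (rule summable_on_cong_neutral) (use out in auto)
  ultimately show "square_summable (\<lambda>n. case n of 0 \<Rightarrow> 0 | Suc m \<Rightarrow> x m)"
    by (simp add: square_summable_def)
  have "infsum ?g UNIV = infsum ?g (range Suc)"
    by (rule infsum_cong_neutral) (use out in auto)
  then show "infsum ?g UNIV = (\<Sum>\<^sub>\<infinity>n. (cmod (x n))\<^sup>2)"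
    by (simp add: infsum_reindex eq)
qed

lemma square_summable_bishift:
  assumes "square_summable (x :: int \<Rightarrow> complex)"
  shows "square_summable (\<lambda>n. x (n - 1))"
    and "(\<Sum>\<^sub>\<infinity>n. (cmod (x (n - 1)))\<^sup>2) = (\<Sum>\<^sub>\<infinity>n. (cmod (x n))\<^sup>2)"
proof -
  have "bij_betw (\<lambda>n::int. n - 1) UNIV UNIV"
    by (rule bij_betwI[where g = "\<lambda>n. n + 1"]) auto
  from summable_on_reindex_bij_betw[OF this, of "\<lambda>n. (cmod (x n))\<^sup>2"]
    infsum_reindex_bij_betw[OF this, of "\<lambda>n. (cmod (x n))\<^sup>2"]
  show "square_summable (\<lambda>n. x (n - 1))"
    and "(\<Sum>\<^sub>\<infinity>n. (cmod (x (n - 1)))\<^sup>2) = (\<Sum>\<^sub>\<infinity>n. (cmod (x n))\<^sup>2)"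
    using assms by (auto simp: square_summable_def)
qed

lemma coeff_basis_vec: "coeff (basis_vec i) j = (if j = i then 1 else 0)"
proof -
  have "(\<lambda>j. (cmod (if j = i then 1 else 0))\<^sup>2) summable_on UNIV \<longleftrightarrow>
        (\<lambda>j. (cmod (if j = i then 1 else 0))\<^sup>2) summable_on {i}"
    by (rule summable_on_cong_neutral) auto
  then have "square_summable (\<lambda>j. if j = i then 1 else 0)"
    unfolding square_summable_def by simp
  then show ?thesis by (simp add: basis_vec_def coeff_ell2)
qed

lemma coeff_diag_op:
  assumes "\<And>i. cmod (a i) \<le> C"
  shows "coeff (diag_op a x) i = a i * coeff x i"
  unfolding diag_op_def
  by (subst coeff_ell2) (auto intro: square_summable_mult square_summable_coeff assms)

lemma coeff_bilateral_shift: "coeff (bilateral_shift x) n = coeff x (n - 1)"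
  by (simp add: bilateral_shift_def coeff_ell2 square_summable_bishift square_summable_coeff)

lemma coeff_unilateral_shift:
  "coeff (unilateral_shift x) n = (case n of 0 \<Rightarrow> 0 | Suc m \<Rightarrow> coeff x m)"
  by (simp add: unilateral_shift_def coeff_ell2 square_summable_shift square_summable_coeff)

lemma bilateral_shift_basis_vec: "bilateral_shift (basis_vec n) = basis_vec (n + 1)"
  by (rule ell2_eqI) (auto simp: coeff_bilateral_shift coeff_basis_vec)

lemma unilateral_shift_basis_vec: "unilateral_shift (basis_vec n) = basis_vec (Suc n)"
  by (rule ell2_eqI) (auto simp: coeff_unilateral_shift coeff_basis_vec split: nat.split)

lemma bounded_clinear_diag_op:
  assumes "\<And>i. cmod (a i) \<le> C"
  shows "bounded_clinear (diag_op a)"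
proof (rule bounded_clinear_ell2I)
  note c = coeff_diag_op[of a, OF assms]
  show "diag_op a (x + y) = diag_op a x + diag_op a y" for x y
    by (rule ell2_eqI) (simp add: c coeff_add algebra_simps)
  show "diag_op a (k *\<^sub>C x) = k *\<^sub>C diag_op a x" for k x
    by (rule ell2_eqI) (simp add: c coeff_scaleC)
  have "0 \<le> C" using assms norm_ge_zero order_trans by blast
  show "norm (diag_op a x) \<le> norm x * C" for x
  proof (rule norm_ell2_le)
    fix F :: "'a set" assume "finite F"
    have "L2_set (\<lambda>i. cmod (coeff (diag_op a x) i)) F \<le> L2_set (\<lambda>i. C * cmod (coeff x i)) F"
      by (rule L2_set_mono) (auto simp: c norm_mult intro: mult_right_mono assms)
    also have "\<dots> = C * L2_set (\<lambda>i. cmod (coeff x i)) F"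
      using \<open>0 \<le> C\<close> by (simp add: L2_set_right_distrib)
    also have "\<dots> \<le> norm x * C"
      using L2_set_coeff_le_norm[OF \<open>finite F\<close>, of x] \<open>0 \<le> C\<close>
      by (subst mult.commute) (rule mult_right_mono)
    finally show "L2_set (\<lambda>i. cmod (coeff (diag_op a x) i)) F \<le> norm x * C" .
  qed
qed

lemma bounded_clinear_bilateral_shift: "bounded_clinear bilateral_shift"
proof (rule bounded_clinear_ell2I)
  show "norm (bilateral_shift x) \<le> norm x * 1" for x
    by (simp add: norm_ell2_def coeff_bilateral_shift square_summable_bishift
        square_summable_coeff)
qed (rule ell2_eqI, simp add: coeff_bilateral_shift coeff_add coeff_scaleC)+

lemma bounded_clinear_unilateral_shift: "bounded_clinear unilateral_shift"
proof (rule bounded_clinear_ell2I)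
  show "norm (unilateral_shift x) \<le> norm x * 1" for x
    by (simp add: norm_ell2_def coeff_unilateral_shift square_summable_shift
        square_summable_coeff)
qed (rule ell2_eqI, simp add: coeff_unilateral_shift coeff_add coeff_scaleC split: nat.split)+


section \<open>The two families of representations\<close>

text \<open>The canonical basis \<open>e\<^sub>1, e\<^sub>2, \<dots>\<close> is indexed by \<^typ>\<open>nat\<close> starting from \<open>0\<close>; hence
  \<open>e\<^sub>1\<close> is \<open>basis_vec 0\<close>, and \<open>\<nu>\<close>, \<open>w\<close> are shifted accordingly. The vector \<open>wbar\<close> is the
  conjugate of the family \<open>w\<close>, which is thereby square-summable.\<close>

definition rank_one_perturbation_type :: "(nat ell2, nat ell2) kronecker \<Rightarrow> bool"
  where "rank_one_perturbation_type F \<longleftrightarrow>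
    (\<exists>(\<nu> :: nat \<Rightarrow> complex) (w :: nat \<Rightarrow> complex) (wbar :: nat ell2).
      bounded (range \<nu>) \<and> (\<forall>i j. i \<noteq> j \<longrightarrow> \<nu> i \<noteq> \<nu> j) \<and>
      (\<forall>n. coeff wbar n = cnj (w n)) \<and> (\<forall>n. w n \<noteq> 0) \<and>
      op_alpha F = unilateral_shift \<and>
      op_beta F = (\<lambda>x. unilateral_shift (diag_op \<nu> x) + rank_one (basis_vec 0) wbar x))"

definition seq_a :: "real \<Rightarrow> int \<Rightarrow> real"
  where "seq_a l n = (if n \<ge> 1 \<and> even n then exp (- (l powi n)) else 1)"

definition seq_b :: "real \<Rightarrow> int \<Rightarrow> real"
  where "seq_b l n = (if n \<ge> 1 \<and> odd n then exp (- (l powi n)) else 1)"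

definition rep_lambda :: "real \<Rightarrow> (int ell2, int ell2) kronecker"
  where "rep_lambda l =
    \<lparr> op_alpha = diag_op (\<lambda>n. complex_of_real (seq_a l n)),
      op_beta = bilateral_shift \<circ> diag_op (\<lambda>n. complex_of_real (seq_b l n)) \<rparr>"

lemma bounded_clinear_compose:
  "bounded_clinear f \<Longrightarrow> bounded_clinear g \<Longrightarrow> bounded_clinear (f \<circ> g)"
  unfolding bounded_clinear_def comp_def by (auto intro: bounded_linear_compose)

lemma hilbert_rep_rep_lambda:
  assumes "l > 1"
  shows "hilbert_rep (rep_lambda l)"
proof -
  have "cmod (complex_of_real (seq_a l n)) \<le> 1" "cmod (complex_of_real (seq_b l n)) \<le> 1" for n
    using assms by (auto simp: seq_a_def seq_b_def)
  then show ?thesis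
    unfolding hilbert_rep_def rep_lambda_def
    by (auto intro!: bounded_clinear_compose bounded_clinear_diag_op bounded_clinear_bilateral_shift)
qed

end

theory Submission
  imports Defs
begin

text \<open>
  \<^bold>\<open>Transitivity.\<close> Let \<open>(T\<^sub>1, T\<^sub>2)\<close> be an endomorphism, with matrices \<open>t\<close> and \<open>s\<close>. Comparing entries
  in \<open>T\<^sub>2 A = A T\<^sub>1\<close> and \<open>T\<^sub>2 B = B T\<^sub>1\<close> gives
  \<open>a(n) s(m,n) = a(m) t(m,n)\<close> and \<open>b(n) s(m+1,n+1) = b(m) t(m,n)\<close>. Eliminating \<open>t\<close> shows that one
  entry of \<open>s\<close> determines all the others on the same diagonal, through the quotients \<open>q = a / b\<close>:
  \<open>s(m+1,n+1) = (q(n) / q(m)) s(m,n)\<close>.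
  The placement of the weights makes \<open>q(n) = exp (-((-l)^n))\<close> for every \<open>n \<ge> 1\<close>, odd or even, so
  that a product of quotients is the exponential of a geometric sum:
  \<open>s(m+k,n+k) = s(m,n) exp (C ((-l)^k - 1))\<close> with \<open>C = ((-l)^n - (-l)^m) / (1 + l)\<close>.
  For \<open>m \<noteq> n\<close> the constant \<open>C\<close> is nonzero, and since \<open>(-l)^k\<close> takes arbitrarily large values of both
  signs, the right-hand side is unbounded unless \<open>s(m,n) = 0\<close>. As the entries of a bounded operator
  are bounded, both matrices are diagonal; the relations then force all diagonal entries to be the
  same number.

  \<^bold>\<open>Non-isomorphism.\<close> An isomorphism carries lower bounds of \<open>f\<^sub>\<alpha>\<close> over. The unilateral shift
  is isometric, whereas \<open>A e\<^sub>n = exp (-l^n) e\<^sub>n\<close> tends to \<open>0\<close> along the even \<open>n\<close>.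
\<close>

section \<open>Bounded operators and the canonical basis\<close>

lemma bounded_clinear_scaleC: "bounded_clinear T \<Longrightarrow> T (c *\<^sub>C x) = c *\<^sub>C T x"
  unfolding bounded_clinear_def by simp

lemma bounded_clinear_bound:
  assumes "bounded_clinear T"
  obtains K where "K > 0" "\<And>x. norm (T x) \<le> norm x * K"
  using assms bounded_linear.pos_bounded unfolding bounded_clinear_def by blast

lemma norm_scaleC: "norm (c *\<^sub>C x) = cmod c * norm (x :: 'a::complex_hilbert_space)"
proof -
  have "complex_of_real ((norm (c *\<^sub>C x))\<^sup>2) = c * cnj c * complex_of_real ((norm x)\<^sup>2)"
    by (metis cinner_norm cinner_scaleC_left cinner_commute complex_cnj_mult mult.assoc
        complex_cnj_complex_of_real)
  also have "\<dots> = complex_of_real ((cmod c * norm x)\<^sup>2)"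
    by (simp add: complex_norm_square [symmetric] power_mult_distrib)
  finally have "(norm (c *\<^sub>C x))\<^sup>2 = (cmod c * norm x)\<^sup>2"
    using of_real_eq_iff by blast
  then show ?thesis
    by simp
qed

lemma bounded_clinear_scalar:
  "bounded_clinear (\<lambda>x :: 'a::complex_hilbert_space. c *\<^sub>C x)"
  unfolding bounded_clinear_def
proof (intro conjI allI)
  show "bounded_linear (\<lambda>x :: 'a. c *\<^sub>C x)"
    by (rule bounded_linear_intro [of _ "cmod c"])
       (simp_all add: scaleC_add_right scaleR_scaleC scaleC_scaleC norm_scaleC mult.commute)
qed (simp add: scaleC_scaleC mult.commute)

lemma norm_basis_vec: "norm (basis_vec i) = 1"
proof -
  have "(\<Sum>\<^sub>\<infinity>j. (cmod (coeff (basis_vec i) j))\<^sup>2) = (\<Sum>\<^sub>\<infinity>j\<in>{i}. 1)"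
    by (rule infsum_cong_neutral) (auto simp: coeff_basis_vec)
  then show ?thesis
    by (simp add: norm_ell2_def)
qed

lemma coeff_sum: "coeff (\<Sum>i\<in>F. f i) j = (\<Sum>i\<in>F. coeff (f i) j)"
  by (induction F rule: infinite_finite_induct) (auto simp: coeff_add coeff_zero)

lemma finite_combinations_dense:
  assumes "e > 0"
  obtains F where "finite F" "norm (x - (\<Sum>i\<in>F. coeff x i *\<^sub>C basis_vec i)) < e"
proof -
  let ?f = "\<lambda>i. (cmod (coeff x i))\<^sup>2"
  have sm: "?f summable_on UNIV"
    using square_summable_coeff unfolding square_summable_def by blast
  have "(sum ?f \<longlongrightarrow> infsum ?f UNIV) (finite_subsets_at_top UNIV)"
    using sm by (rule infsum_tendsto)
  then have "eventually (\<lambda>F. dist (sum ?f F) (infsum ?f UNIV) < e\<^sup>2) (finite_subsets_at_top UNIV)"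
    using assms by (intro tendstoD) auto
  then obtain F where F: "finite F" "dist (sum ?f F) (infsum ?f UNIV) < e\<^sup>2"
    unfolding eventually_finite_subsets_at_top by blast
  let ?r = "x - (\<Sum>i\<in>F. coeff x i *\<^sub>C basis_vec i)"
  have r: "coeff ?r j = (if j \<in> F then 0 else coeff x j)" for j
    using F(1) by (simp add: coeff_diff coeff_sum coeff_scaleC coeff_basis_vec if_distrib
        sum.delta' cong: if_cong)
  have "(\<Sum>\<^sub>\<infinity>j. (cmod (coeff ?r j))\<^sup>2) = infsum ?f (UNIV - F)"
    by (rule infsum_cong_neutral) (auto simp: r)
  also have "\<dots> = infsum ?f UNIV - sum ?f F"
    using F(1) sm by (subst infsum_Diff) auto
  also have "\<dots> < e\<^sup>2"
    using F(2) by (simp add: dist_real_def abs_less_iff)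
  finally have "norm ?r < sqrt (e\<^sup>2)"
    unfolding norm_ell2_def by (rule real_sqrt_less_mono)
  with F(1) assms that show thesis
    by simp
qed

lemma bounded_clinear_eqI_basis:
  assumes T: "bounded_clinear T" and R: "bounded_clinear R"
    and basis: "\<And>i. T (basis_vec i) = R (basis_vec i)"
  shows "T x = R x"
proof -
  have lin: "linear T" "linear R"
    using T R unfolding bounded_clinear_def by (auto dest: bounded_linear.linear)
  obtain K where K: "K > 0" "\<And>y. norm (T y) \<le> norm y * K"
    using bounded_clinear_bound [OF T] by blast
  obtain L where L: "L > 0" "\<And>y. norm (R y) \<le> norm y * L"
    using bounded_clinear_bound [OF R] by blast
  have "norm (T x - R x) \<le> d" if "d > 0" for d
  proof -
    obtain F where F: "finite F"
        "norm (x - (\<Sum>i\<in>F. coeff x i *\<^sub>C basis_vec i)) < d / (K + L)"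
      using finite_combinations_dense [of "d / (K + L)"] \<open>d > 0\<close> K(1) L(1)
      by (metis add_pos_pos divide_pos_pos)
    let ?p = "\<Sum>i\<in>F. coeff x i *\<^sub>C basis_vec i"
    have "T ?p = R ?p"
      by (simp add: linear_sum lin bounded_clinear_scaleC T R basis)
    then have "T x - R x = T (x - ?p) - R (x - ?p)"
      by (simp add: linear_diff lin)
    also have "norm \<dots> \<le> norm (x - ?p) * K + norm (x - ?p) * L"
      by (rule order_trans [OF norm_triangle_ineq4 add_mono [OF K(2) L(2)]])
    also have "\<dots> = norm (x - ?p) * (K + L)"
      by (simp add: algebra_simps)
    also have "\<dots> \<le> d / (K + L) * (K + L)"
      using F(2) K(1) L(1) by (intro mult_right_mono) auto
    also have "\<dots> = d"
      using K(1) L(1) by simp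
    finally show ?thesis .
  qed
  then have "norm (T x - R x) \<le> 0"
    by (rule field_le_epsilon) simp
  then show ?thesis
    by simp
qed


section \<open>The two weight sequences\<close>

lemma seq_a_pos: "seq_a l n > 0"
  by (simp add: seq_a_def)

lemma seq_b_pos: "seq_b l n > 0"
  by (simp add: seq_b_def)

lemma cmod_seq_le_1:
  assumes "l > 1"
  shows "cmod (complex_of_real (seq_a l n)) \<le> 1" "cmod (complex_of_real (seq_b l n)) \<le> 1"
  using assms by (auto simp: seq_a_def seq_b_def)

text \<open>The sign of \<open>(-l)^n\<close> records which of the two weights is nontrivial at \<open>n\<close>; this removes
  the case distinction on parity from everything that follows.\<close>

lemma seq_a_eq_seq_b_times:
  assumes "n \<ge> 1"
  shows "seq_a l (int n) = seq_b l (int n) * exp (- ((- l) ^ n))"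
  using assms by (simp add: seq_a_def seq_b_def exp_minus)

lemma exp_alternating_power_unbounded:
  fixes l C K :: real
  assumes "l > 1" "C \<noteq> 0"
  obtains k where "exp (C * (- l) ^ k) > K"
proof -
  \<comment> \<open>The parity of \<open>k\<close> is chosen to match the sign of \<open>C\<close>, so that
    \<open>C (-l)^k = D l^(2 j)\<close> with \<open>D > 0\<close> in both cases.\<close>
  define D where "D = (if C > 0 then C else - C * l)"
  have D: "D > 0"
    using assms by (auto simp: D_def mult_neg_pos)
  have "1 < l\<^sup>2"
    using assms by (simp add: one_less_power)
  then obtain j where j: "K / D < (l\<^sup>2) ^ j"
    using real_arch_pow by blast
  define k where "k = (if C > 0 then 2 * j else 2 * j + 1)"
  have "C * (- l) ^ k = D * (l\<^sup>2) ^ j"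
    by (simp add: k_def D_def power_mult)
  moreover have "K < D * (l\<^sup>2) ^ j"
    using j D by (simp add: field_simps)
  moreover have "D * (l\<^sup>2) ^ j < exp (D * (l\<^sup>2) ^ j)"
    using exp_ge_add_one_self [of "D * (l\<^sup>2) ^ j"] by linarith
  ultimately show thesis
    using that [of k] by simp
qed


section \<open>Bounded intertwining matrices\<close>

text \<open>The locale isolates what the endomorphism equations say about matrix entries, together with
  the only analytic information needed: boundedness of the entries of \<open>s\<close>.\<close>

locale intertwining_matrices =
  fixes l :: real and s t :: "int \<Rightarrow> int \<Rightarrow> complex" and K :: real
  assumes l: "l > 1"
    and rel_a: "seq_a l n * s m n = seq_a l m * t m n"
    and rel_b: "seq_b l n * s (m + 1) (n + 1) = seq_b l m * t m n"
    and bound: "cmod (s m n) \<le> K"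
begin

lemma s_step:
  "seq_b l n * seq_a l m * s (m + 1) (n + 1) = seq_a l n * seq_b l m * s m n"
  using rel_a [of n m] rel_b [of n m] by (simp add: algebra_simps)

lemma s_zero_iff_shift: "s (m + int k) (n + int k) = 0 \<longleftrightarrow> s m n = 0"
proof (induction k)
  case (Suc k)
  have "s (m + int k + 1) (n + int k + 1) = 0 \<longleftrightarrow> s (m + int k) (n + int k) = 0"
    using s_step [of "n + int k" "m + int k"] seq_a_pos [of l] seq_b_pos [of l]
    by (metis less_irrefl mult_eq_0_iff of_real_eq_0_iff)
  with Suc show ?case
    by (simp add: ac_simps)
qed simp

lemma s_step_exp:
  assumes "m \<ge> 1" "n \<ge> 1"
  shows "s (int m + 1) (int n + 1) = s (int m) (int n) * exp ((- l) ^ m - (- l) ^ n)"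
proof -
  let ?B = "complex_of_real (seq_b l (int n) * seq_b l (int m))"
  have "?B * (s (int m + 1) (int n + 1) * exp (- ((- l) ^ m))) =
      ?B * (s (int m) (int n) * exp (- ((- l) ^ n)))"
    using s_step [of "int n" "int m"] assms by (simp add: seq_a_eq_seq_b_times mult_ac)
  moreover have "?B \<noteq> 0"
    using seq_b_pos [of l "int n"] seq_b_pos [of l "int m"] by simp
  ultimately have eq: "s (int m + 1) (int n + 1) * exp (- ((- l) ^ m)) =
      s (int m) (int n) * exp (- ((- l) ^ n))"
    using mult_left_cancel by blast
  have unit: "complex_of_real (exp (- x)) * complex_of_real (exp x) = 1" for x
    by (simp flip: of_real_mult exp_add)
  have "s (int m + 1) (int n + 1) =
      s (int m + 1) (int n + 1) * exp (- ((- l) ^ m)) * exp ((- l) ^ m)"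
    by (simp only: mult.assoc unit mult_1_right)
  also have "\<dots> = s (int m) (int n) * exp (- ((- l) ^ n)) * exp ((- l) ^ m)"
    by (simp only: eq)
  also have "\<dots> = s (int m) (int n) * exp ((- l) ^ m - (- l) ^ n)"
    by (simp only: mult.assoc of_real_mult [symmetric] exp_add [symmetric] uminus_add_conv_diff)
  finally show ?thesis .
qed

text \<open>The function \<open>k \<mapsto> ((-l)^(n+k) - (-l)^(m+k)) / (1 + l)\<close> is a primitive of the exponents in
  \<open>s_step_exp\<close>, because \<open>(-l)^(n+1) - (-l)^n = -(1 + l) (-l)^n\<close>.\<close>

lemma s_diagonal_formula:
  assumes "m \<ge> 1" "n \<ge> 1"
  defines "C \<equiv> ((- l) ^ n - (- l) ^ m) / (1 + l)"
  shows "s (int m + int k) (int n + int k) = s (int m) (int n) * exp (C * ((- l) ^ k - 1))"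
proof (induction k)
  case (Suc k)
  have "1 + l \<noteq> 0"
    using l by simp
  then have e: "C * ((- l) ^ k - 1) + ((- l) ^ (m + k) - (- l) ^ (n + k)) = C * ((- l) ^ Suc k - 1)"
    unfolding C_def by (simp add: field_simps power_add)
  have "s (int m + int (Suc k)) (int n + int (Suc k)) =
      s (int m + int k) (int n + int k) * exp ((- l) ^ (m + k) - (- l) ^ (n + k))"
    using s_step_exp [of "m + k" "n + k"] assms(1,2) by (simp add: ac_simps)
  also have "\<dots> = s (int m) (int n) * complex_of_real
      (exp (C * ((- l) ^ k - 1)) * exp ((- l) ^ (m + k) - (- l) ^ (n + k)))"
    unfolding Suc.IH by simp
  also have "\<dots> = s (int m) (int n) * exp (C * ((- l) ^ Suc k - 1))"
    unfolding exp_add [symmetric] e by simp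
  finally show ?case .
qed simp

lemma s_off_diagonal_nat:
  assumes "m \<ge> 1" "n \<ge> 1" "m \<noteq> n"
  shows "s (int m) (int n) = 0"
proof (rule ccontr)
  assume nz: "s (int m) (int n) \<noteq> 0"
  define C where "C = ((- l) ^ n - (- l) ^ m) / (1 + l)"
  have abs: "\<bar>(- l) ^ i\<bar> = l ^ i" for i
    using l by (simp add: power_abs)
  have "l ^ n \<noteq> l ^ m"
    using l assms(3) by (simp add: power_inject_exp)
  then have "(- l) ^ n - (- l) ^ m \<noteq> 0"
    using abs [of n] abs [of m] by (metis eq_iff_diff_eq_0)
  then have "C \<noteq> 0"
    using l by (auto simp: C_def)
  then obtain k where k: "exp (C * (- l) ^ k) > K / (cmod (s (int m) (int n)) * exp (- C))"
    using exp_alternating_power_unbounded l by blast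
  have "K < cmod (s (int m) (int n)) * exp (- C) * exp (C * (- l) ^ k)"
    using k nz by (simp add: field_simps)
  also have "\<dots> = cmod (s (int m) (int n)) * exp (C * ((- l) ^ k - 1))"
    by (simp add: exp_add [symmetric] algebra_simps)
  also have "\<dots> = cmod (s (int m + int k) (int n + int k))"
    unfolding s_diagonal_formula [OF assms(1,2)] C_def by (simp add: norm_mult)
  finally show False
    using bound [of "int m + int k" "int n + int k"] by linarith
qed

lemma off_diagonal:
  assumes "m \<noteq> n"
  shows "s m n = 0" "t m n = 0"
proof -
  \<comment> \<open>This translation moves both indices into the range \<open>\<ge> 1\<close>, where the quotients of the weights
    have their exponential form.\<close>
  define k where "k = nat (1 + \<bar>m\<bar> + \<bar>n\<bar>)"
  have "s (int (nat (m + int k))) (int (nat (n + int k))) = 0"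
    by (rule s_off_diagonal_nat) (use assms in \<open>auto simp: k_def\<close>)
  then have "s (m + int k) (n + int k) = 0"
    by (simp add: k_def split: if_splits)
  then show "s m n = 0"
    by (simp add: s_zero_iff_shift)
  then show "t m n = 0"
    using rel_a [of n m] seq_a_pos [of l m] by simp
qed

lemma diagonal_constant: "s n n = s 0 0" "t n n = s 0 0"
proof -
  have st: "t i i = s i i" for i
    using rel_a [of i i] seq_a_pos [of l i] by simp
  have step: "s (i + 1) (i + 1) = s i i" for i
    using rel_b [of i i] seq_b_pos [of l i] by (simp add: st)
  show "s n n = s 0 0"
  proof (induction n rule: int_induct [where k = 0])
    case (step2 i)
    with step [of "i - 1"] show ?case by simp
  qed (simp_all add: step)
  then show "t n n = s 0 0"
    by (simp add: st)
qed

end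


section \<open>Transitivity\<close>

lemma coeff_rep_lambda:
  assumes "l > 1"
  shows "coeff (op_alpha (rep_lambda l) x) n = seq_a l n * coeff x n"
    and "coeff (op_beta (rep_lambda l) x) n = seq_b l (n - 1) * coeff x (n - 1)"
  by (simp_all add: rep_lambda_def coeff_bilateral_shift coeff_diag_op [OF cmod_seq_le_1(1) [OF assms]]
      coeff_diag_op [OF cmod_seq_le_1(2) [OF assms]])

lemma rep_lambda_basis_vec:
  assumes "l > 1"
  shows "op_alpha (rep_lambda l) (basis_vec n) = complex_of_real (seq_a l n) *\<^sub>C basis_vec n"
    and "op_beta (rep_lambda l) (basis_vec n) = complex_of_real (seq_b l n) *\<^sub>C basis_vec (n + 1)"
  by (rule ell2_eqI, auto simp: coeff_rep_lambda [OF assms] coeff_scaleC coeff_basis_vec)+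

lemma endomorphism_matrices:
  assumes l: "l > 1" and hom: "(T1, T2) \<in> rep_hom (rep_lambda l) (rep_lambda l)"
  obtains K where "intertwining_matrices l
    (\<lambda>m n. coeff (T2 (basis_vec n)) m) (\<lambda>m n. coeff (T1 (basis_vec n)) m) K"
proof -
  let ?F = "rep_lambda l"
  have T2: "bounded_clinear T2"
    and a: "T2 (op_alpha ?F x) = op_alpha ?F (T1 x)"
    and b: "T2 (op_beta ?F x) = op_beta ?F (T1 x)" for x
    using hom by (auto simp: rep_hom_def fun_eq_iff)
  obtain K where K: "\<And>x. norm (T2 x) \<le> norm x * K"
    using bounded_clinear_bound [OF T2] by blast
  show thesis
  proof (rule that, unfold_locales)
    fix m n :: int
    show "l > 1" by (rule l)
    show "seq_a l n * coeff (T2 (basis_vec n)) m = seq_a l m * coeff (T1 (basis_vec n)) m"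
      using arg_cong [OF a [of "basis_vec n"], of "\<lambda>x. coeff x m"]
      by (simp add: coeff_rep_lambda rep_lambda_basis_vec l bounded_clinear_scaleC [OF T2]
          coeff_scaleC)
    show "seq_b l n * coeff (T2 (basis_vec (n + 1))) (m + 1) =
        seq_b l m * coeff (T1 (basis_vec n)) m"
      using arg_cong [OF b [of "basis_vec n"], of "\<lambda>x. coeff x (m + 1)"]
      by (simp add: coeff_rep_lambda rep_lambda_basis_vec l bounded_clinear_scaleC [OF T2]
          coeff_scaleC)
    show "cmod (coeff (T2 (basis_vec n)) m) \<le> K"
      using cmod_coeff_le_norm [of "T2 (basis_vec n)" m] K [of "basis_vec n"]
      by (simp add: norm_basis_vec)
  qed
qed

lemma scalars_in_rep_hom:
  assumes "hilbert_rep F"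
  shows "(\<lambda>x. c *\<^sub>C x, \<lambda>y. c *\<^sub>C y) \<in> rep_hom F F"
  using assms unfolding rep_hom_def hilbert_rep_def
  by (auto simp: bounded_clinear_scalar bounded_clinear_scaleC fun_eq_iff)

lemma transitive_rep_lambda:
  assumes l: "l > 1"
  shows "transitive_rep (rep_lambda l)"
  unfolding transitive_rep_def
proof (intro equalityI subsetI)
  fix T assume "T \<in> rep_hom (rep_lambda l) (rep_lambda l)"
  then obtain T1 T2 where T: "T = (T1, T2)"
    and hom: "(T1, T2) \<in> rep_hom (rep_lambda l) (rep_lambda l)"
    by (cases T) auto
  have bl: "bounded_clinear T1" "bounded_clinear T2"
    using hom by (auto simp: rep_hom_def)
  define c where "c = coeff (T2 (basis_vec 0)) 0"
  obtain K where "intertwining_matrices l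
      (\<lambda>m n. coeff (T2 (basis_vec n)) m) (\<lambda>m n. coeff (T1 (basis_vec n)) m) K"
    using endomorphism_matrices [OF l hom] .
  then interpret intertwining_matrices l
    "\<lambda>m n. coeff (T2 (basis_vec n)) m" "\<lambda>m n. coeff (T1 (basis_vec n)) m" K .
  have "coeff (T1 (basis_vec n)) n = c" "coeff (T2 (basis_vec n)) n = c" for n
    unfolding c_def by (fact diagonal_constant)+
  then have "T1 (basis_vec n) = c *\<^sub>C basis_vec n" "T2 (basis_vec n) = c *\<^sub>C basis_vec n" for n
    by (auto intro!: ell2_eqI simp: coeff_scaleC coeff_basis_vec off_diagonal)
  then have "T1 x = c *\<^sub>C x" "T2 x = c *\<^sub>C x" for x
    using bl bounded_clinear_scalar by (auto intro: bounded_clinear_eqI_basis)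
  then have "T = (\<lambda>x. c *\<^sub>C x, \<lambda>y. c *\<^sub>C y)"
    by (auto simp: T)
  then show "T \<in> range (\<lambda>c. (\<lambda>x. c *\<^sub>C x, \<lambda>y. c *\<^sub>C y))"
    by blast
next
  fix T :: "(int ell2 \<Rightarrow> int ell2) \<times> (int ell2 \<Rightarrow> int ell2)"
  assume "T \<in> range (\<lambda>c. (\<lambda>x. c *\<^sub>C x, \<lambda>y. c *\<^sub>C y))"
  then show "T \<in> rep_hom (rep_lambda l) (rep_lambda l)"
    using scalars_in_rep_hom [OF hilbert_rep_rep_lambda [OF l]] by auto
qed


section \<open>Lower bounds as an isomorphism invariant\<close>

lemma norm_unilateral_shift: "norm (unilateral_shift x) = norm x"
  by (simp add: norm_ell2_def coeff_unilateral_shift square_summable_shift(2) square_summable_coeff)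

text \<open>From \<open>T\<^sub>2 f\<^sub>\<alpha> = g\<^sub>\<alpha> T\<^sub>1\<close> with \<open>g\<^sub>\<alpha>\<close> isometric, \<open>f\<^sub>\<alpha> x\<close> can only be small if \<open>T\<^sub>1 x\<close> is, and
  \<open>T\<^sub>1\<close> has a bounded inverse.\<close>

lemma rep_isomorphic_bounded_below:
  assumes iso: "rep_isomorphic F G" and isometry: "\<And>y. norm (op_alpha G y) = norm y"
  obtains k where "k > 0" "\<And>x. k * norm x \<le> norm (op_alpha F x)"
proof -
  obtain T1 T2 where hom: "(T1, T2) \<in> rep_hom F G" and inv: "boundedly_invertible T1"
    using iso unfolding rep_isomorphic_def by blast
  have T2: "bounded_clinear T2" and com: "T2 (op_alpha F x) = op_alpha G (T1 x)" for x
    using hom by (auto simp: rep_hom_def fun_eq_iff)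
  obtain R where R: "bounded_clinear R" "\<And>x. R (T1 x) = x"
    using inv unfolding boundedly_invertible_def by (auto simp: fun_eq_iff)
  obtain K where K: "K > 0" "\<And>x. norm (T2 x) \<le> norm x * K"
    using bounded_clinear_bound [OF T2] by blast
  obtain L where L: "L > 0" "\<And>x. norm (R x) \<le> norm x * L"
    using bounded_clinear_bound [OF R(1)] by blast
  have "1 / (K * L) * norm x \<le> norm (op_alpha F x)" for x
  proof -
    have "norm x \<le> norm (T1 x) * L"
      using L(2) [of "T1 x"] R(2) by simp
    also have "norm (T1 x) = norm (T2 (op_alpha F x))"
      by (simp add: com isometry)
    also have "\<dots> * L \<le> norm (op_alpha F x) * K * L"
      using K(2) L(1) by simp
    finally show ?thesis
      using K(1) L(1) by (simp add: field_simps)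
  qed
  with K(1) L(1) show thesis
    by (intro that [of "1 / (K * L)"]) auto
qed

lemma rep_lambda_alpha_not_bounded_below:
  assumes l: "l > 1" and "k > 0"
  obtains x where "norm (op_alpha (rep_lambda l) x) < k * norm x"
proof -
  obtain j where j: "(l\<^sup>2) ^ j > 1 / k"
    using real_arch_pow [of "l\<^sup>2" "1 / k"] l by (auto simp: one_less_power)
  define n where "n = 2 * Suc j"
  have "(l\<^sup>2) ^ j \<le> l ^ n"
    using l power_increasing [of "2 * j" n l] by (simp add: n_def flip: power_mult)
  also have "\<dots> < exp (l ^ n)"
    using exp_ge_add_one_self [of "l ^ n"] by linarith
  finally have "1 / k < exp (l ^ n)"
    using j by linarith
  then have "exp (- (l ^ n)) < k"
    using \<open>k > 0\<close> by (simp add: exp_minus field_simps)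
  moreover have "seq_a l (int n) = exp (- (l ^ n))"
    unfolding seq_a_def power_int_of_nat by (simp add: n_def)
  ultimately show thesis
    by (intro that [of "basis_vec (int n)"])
       (simp add: rep_lambda_basis_vec l norm_scaleC norm_basis_vec)
qed

theorem theorem3p8:
  fixes l :: real
  assumes "l > 1"
  shows "hilbert_rep (rep_lambda l) \<and> transitive_rep (rep_lambda l) \<and>
    (\<forall>G. rank_one_perturbation_type G \<longrightarrow> \<not> rep_isomorphic (rep_lambda l) G)"
proof (intro conjI allI impI notI)
  show "hilbert_rep (rep_lambda l)"
    using assms by (rule hilbert_rep_rep_lambda)
  show "transitive_rep (rep_lambda l)"
    using assms by (rule transitive_rep_lambda)
next
  fix G assume G: "rank_one_perturbation_type G" and iso: "rep_isomorphic (rep_lambda l) G"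
  have "op_alpha G = unilateral_shift"
    using G unfolding rank_one_perturbation_type_def by blast
  then obtain k where "k > 0" "\<And>x. k * norm x \<le> norm (op_alpha (rep_lambda l) x)"
    using rep_isomorphic_bounded_below [OF iso] norm_unilateral_shift by metis
  with rep_lambda_alpha_not_bounded_below [OF assms] show False
    by (meson not_less)
qed

end
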